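(* Let $k\ge1$ and let $\Gamma^k$ be the $k$-fold free product of the cyclic group of two elements. Then for any transitive, faithful action of $\Gamma^k$ on a countably infinite set $X$, the associated lamplighter group $\bigoplus_{x\in X}\{0,1\}\rtimes\Gamma^k$ is LEF (locally embeddable into finite groups).
   Context: Let a countable group $\Gamma$ act faithfully and transitively on a countably infinite set $X$. Then $\Gamma$ acts by automorphisms on the abelian group $\bigoplus_{x\in X}\{0,1\}$ (finitely supported functions $X\to\mathbf Z/2$) by permuting coordinates: $(\gamma\cdot a)(q)=a(\gamma^{-1}q)$. The lamplighter group of the action is the semidirect product $\bigoplus_{x\in X}\{0,1\}\rtimes\Gamma$ for this action. For a finite nonempty set $A$, $Map(A)$ is the set of all maps $A\to A$ with composition, and $d_H(\alpha,\beta)=\frac{|\{x\in A:\alpha(x)\neq\beta(x)\}|}{|A|}$. A group $\Gamma$ is LEF if for every finite $F\subset\Gamma$ and $\epsilon>0$ there exist a finite nonempty set $A$ and a map $\Theta:\Gamma\to Map(A)$ such that $\Theta(fg)=\Theta(f)\Theta(g)$ whenever $f,g,fg\in F$; $d_H(\Theta(f),1)>1-\epsilon$ whenever $1\ne f\in F$; and $\Theta(1)=1$. (Equivalently: for every finite $F\subset\Gamma$ there are a finite group $H$ and an injective map $\Theta:F\to H$ with $\Theta(fg)=\Theta(f)\Theta(g)$ whenever $f,g,fg\in F$.) *)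

theory Defs
  imports Complex_Main "HOL-Algebra.Group_Action" "HOL-Algebra.Product_Groups"
begin

section \<open>Free products\<close>

definition free_product_words ::
    "'i set \<Rightarrow> ('i \<Rightarrow> ('a, 'b) monoid_scheme) \<Rightarrow> ('i \<times> 'a) list set"
  where "free_product_words I G = lists (SIGMA i:I. carrier (G i))"

inductive_set free_product_rel ::
    "'i set \<Rightarrow> ('i \<Rightarrow> ('a, 'b) monoid_scheme) \<Rightarrow> (('i \<times> 'a) list \<times> ('i \<times> 'a) list) set"
  for I :: "'i set" and G :: "'i \<Rightarrow> ('a, 'b) monoid_scheme"
where
  refl: "w \<in> free_product_words I G \<Longrightarrow> (w, w) \<in> free_product_rel I G"
| sym: "(v, w) \<in> free_product_rel I G \<Longrightarrow> (w, v) \<in> free_product_rel I G"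
| trans: "(u, v) \<in> free_product_rel I G \<Longrightarrow> (v, w) \<in> free_product_rel I G
    \<Longrightarrow> (u, w) \<in> free_product_rel I G"
| one: "u \<in> free_product_words I G \<Longrightarrow> v \<in> free_product_words I G \<Longrightarrow> i \<in> I
    \<Longrightarrow> (u @ [(i, \<one>\<^bsub>G i\<^esub>)] @ v, u @ v) \<in> free_product_rel I G"
| mult: "u \<in> free_product_words I G \<Longrightarrow> v \<in> free_product_words I G \<Longrightarrow> i \<in> I
    \<Longrightarrow> x \<in> carrier (G i) \<Longrightarrow> y \<in> carrier (G i)
    \<Longrightarrow> (u @ [(i, x), (i, y)] @ v, u @ [(i, x \<otimes>\<^bsub>G i\<^esub> y)] @ v) \<in> free_product_rel I G"

text \<open>The free product of a family of groups: words in the disjoint union of the factors modulo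
  the congruence that deletes identity letters and multiplies adjacent letters of the same
  factor.\<close>

definition free_product ::
    "'i set \<Rightarrow> ('i \<Rightarrow> ('a, 'b) monoid_scheme) \<Rightarrow> ('i \<times> 'a) list set monoid"
  where "free_product I G =
    \<lparr>carrier = free_product_words I G // free_product_rel I G,
     monoid.mult = (\<lambda>P Q. \<Union>p\<in>P. \<Union>q\<in>Q. free_product_rel I G `` {p @ q}),
     one = free_product_rel I G `` {[]}\<rparr>"

definition free_power_C2 :: "nat \<Rightarrow> (nat \<times> int) list set monoid"
  where "free_power_C2 k = free_product {..<k} (\<lambda>_. integer_mod_group 2)"


section \<open>Semidirect products and lamplighter groups\<close>

definition semidirect_product ::
    "('n, 'c) monoid_scheme \<Rightarrow> ('h, 'd) monoid_scheme \<Rightarrow> ('h \<Rightarrow> 'n \<Rightarrow> 'n) \<Rightarrow> ('n \<times> 'h) monoid"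
  where "semidirect_product N H \<alpha> =
    \<lparr>carrier = carrier N \<times> carrier H,
     monoid.mult = (\<lambda>(a, g) (b, h). (a \<otimes>\<^bsub>N\<^esub> \<alpha> g b, g \<otimes>\<^bsub>H\<^esub> h)),
     one = (\<one>\<^bsub>N\<^esub>, \<one>\<^bsub>H\<^esub>)\<rparr>"

abbreviation lamp_group :: "'x set \<Rightarrow> ('x \<Rightarrow> int) monoid"
  where "lamp_group X \<equiv> sum_group X (\<lambda>_. integer_mod_group 2)"

definition permute_lamps ::
    "('g, 'b) monoid_scheme \<Rightarrow> 'x set \<Rightarrow> ('g \<Rightarrow> 'x \<Rightarrow> 'x) \<Rightarrow> 'g \<Rightarrow> ('x \<Rightarrow> int) \<Rightarrow> ('x \<Rightarrow> int)"
  where "permute_lamps G X \<phi> g a = (\<lambda>q\<in>X. a (\<phi> (inv\<^bsub>G\<^esub> g) q))"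

definition lamplighter_group ::
    "('g, 'b) monoid_scheme \<Rightarrow> 'x set \<Rightarrow> ('g \<Rightarrow> 'x \<Rightarrow> 'x) \<Rightarrow> (('x \<Rightarrow> int) \<times> 'g) monoid"
  where "lamplighter_group G X \<phi> = semidirect_product (lamp_group X) G (permute_lamps G X \<phi>)"


section \<open>LEF groups\<close>

definition hamming_dist :: "'a set \<Rightarrow> ('a \<Rightarrow> 'b) \<Rightarrow> ('a \<Rightarrow> 'b) \<Rightarrow> real"
  where "hamming_dist A \<alpha> \<beta> = real (card {x \<in> A. \<alpha> x \<noteq> \<beta> x}) / real (card A)"

text \<open>Self-maps of \<open>A\<close> are represented extensionally, as elements of \<open>A \<rightarrow>\<^sub>E A\<close>.
  Taking the finite sets \<open>A\<close> inside \<^typ>\<open>nat\<close> loses no generality.\<close>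

definition LEF :: "('g, 'b) monoid_scheme \<Rightarrow> bool"
  where "LEF G \<longleftrightarrow> group G \<and>
    (\<forall>F \<epsilon>. finite F \<and> F \<subseteq> carrier G \<and> (0::real) < \<epsilon> \<longrightarrow>
      (\<exists>(A :: nat set) \<Theta>. finite A \<and> A \<noteq> {} \<and>
         \<Theta> \<in> carrier G \<rightarrow> (A \<rightarrow>\<^sub>E A) \<and>
         (\<forall>f\<in>F. \<forall>g\<in>F. f \<otimes>\<^bsub>G\<^esub> g \<in> F \<longrightarrow> \<Theta> (f \<otimes>\<^bsub>G\<^esub> g) = compose A (\<Theta> f) (\<Theta> g)) \<and>
         (\<forall>f\<in>F. f \<noteq> \<one>\<^bsub>G\<^esub> \<longrightarrow> hamming_dist A (\<Theta> f) (\<lambda>x\<in>A. x) > 1 - \<epsilon>) \<and>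
         \<Theta> \<one>\<^bsub>G\<^esub> = (\<lambda>x\<in>A. x)))"


section \<open>Well-definedness of the constructions\<close>

lemma free_product_words_append [simp]:
  "u @ v \<in> free_product_words I G \<longleftrightarrow> u \<in> free_product_words I G \<and> v \<in> free_product_words I G"
  by (auto simp: free_product_words_def)

lemma free_product_words_Nil [simp]: "[] \<in> free_product_words I G"
  by (auto simp: free_product_words_def)

lemma free_product_words_Cons [simp]:
  "(i, x) # v \<in> free_product_words I G \<longleftrightarrow>
    i \<in> I \<and> x \<in> carrier (G i) \<and> v \<in> free_product_words I G"
  by (auto simp: free_product_words_def)

locale group_family =
  fixes I :: "'i set" and G :: "'i \<Rightarrow> ('a, 'b) monoid_scheme"
  assumes group_factor: "i \<in> I \<Longrightarrow> group (G i)"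
begin

abbreviation "W \<equiv> free_product_words I G"
abbreviation "R \<equiv> free_product_rel I G"

lemma one_factor: "i \<in> I \<Longrightarrow> \<one>\<^bsub>G i\<^esub> \<in> carrier (G i)"
  using group_factor by (simp add: group.is_monoid monoid.one_closed)

lemma mult_factor:
  "i \<in> I \<Longrightarrow> x \<in> carrier (G i) \<Longrightarrow> y \<in> carrier (G i) \<Longrightarrow> x \<otimes>\<^bsub>G i\<^esub> y \<in> carrier (G i)"
  using group_factor by (simp add: group.is_monoid monoid.m_closed)

lemma rel_words: "(v, w) \<in> R \<Longrightarrow> v \<in> W \<and> w \<in> W"
  by (induction rule: free_product_rel.induct) (auto simp: one_factor mult_factor)

lemma equiv_rel: "equiv W R"
  using rel_words
  by (intro equivI refl_onI symI transI)
     (auto intro: free_product_rel.refl free_product_rel.sym free_product_rel.trans)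

lemma rel_context: "(v, w) \<in> R \<Longrightarrow> a \<in> W \<Longrightarrow> b \<in> W \<Longrightarrow> (a @ v @ b, a @ w @ b) \<in> R"
proof (induction rule: free_product_rel.induct)
  case (refl w) then show ?case by (simp add: free_product_rel.refl)
next
  case (sym v w) then show ?case by (simp add: free_product_rel.sym)
next
  case (trans u v w) then show ?case by (metis free_product_rel.trans)
next
  case (one u v i) then show ?case
    using free_product_rel.one[of "a @ u" I G "v @ b" i] by simp
next
  case (mult u v i x y) then show ?case
    using free_product_rel.mult[of "a @ u" I G "v @ b" i x y] by simp
qed

lemma rel_append:
  assumes "(v, v') \<in> R" "(w, w') \<in> R"
  shows "(v @ w, v' @ w') \<in> R"
  using rel_context[OF assms(1), of "[]" w] rel_context[OF assms(2), of v' "[]"]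
    rel_words[OF assms(1)] rel_words[OF assms(2)] free_product_rel.trans by fastforce

lemma mult_class:
  assumes "v \<in> W" "w \<in> W"
  shows "(R `` {v}) \<otimes>\<^bsub>free_product I G\<^esub> (R `` {w}) = R `` {v @ w}"
proof -
  have eq: "R `` {p @ q} = R `` {v @ w}" if "p \<in> R `` {v}" "q \<in> R `` {w}" for p q
  proof -
    have "(v @ w, p @ q) \<in> R" using that by (simp add: rel_append)
    then show ?thesis by (rule equiv_class_eq[OF equiv_rel, symmetric])
  qed
  have "v \<in> R `` {v}" "w \<in> R `` {w}"
    using assms free_product_rel.refl by auto
  then have "(\<Union>p\<in>R `` {v}. \<Union>q\<in>R `` {w}. R `` {p @ q}) = R `` {v @ w}"
    using eq by blast
  then show ?thesis by (simp add: free_product_def)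
qed

lemma class_in_carrier: "w \<in> W \<Longrightarrow> R `` {w} \<in> carrier (free_product I G)"
  by (simp add: free_product_def quotientI)

lemma left_inverse_word:
  assumes "w \<in> W" shows "\<exists>v\<in>W. (v @ w, []) \<in> R"
  using assms
proof (induction w)
  case Nil
  then show ?case using free_product_rel.refl by force
next
  case (Cons l w)
  obtain i x where l: "l = (i, x)" by fastforce
  with Cons.prems have ix: "i \<in> I" "x \<in> carrier (G i)" "w \<in> W" by auto
  interpret group "G i" by (rule group_factor[OF ix(1)])
  obtain v where v: "v \<in> W" "(v @ w, []) \<in> R" using Cons.IH ix by blast
  have "(v @ [(i, inv\<^bsub>G i\<^esub> x), (i, x)] @ w, v @ [(i, inv\<^bsub>G i\<^esub> x \<otimes>\<^bsub>G i\<^esub> x)] @ w) \<in> R"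
    using v ix by (intro free_product_rel.mult) auto
  moreover have "(v @ [(i, inv\<^bsub>G i\<^esub> x \<otimes>\<^bsub>G i\<^esub> x)] @ w, v @ w) \<in> R"
    using v ix free_product_rel.one[of v I G w i] by simp
  ultimately have "(v @ [(i, inv\<^bsub>G i\<^esub> x), (i, x)] @ w, []) \<in> R"
    using v(2) free_product_rel.trans by metis
  then show ?case
    using v ix l by (intro bexI[of _ "v @ [(i, inv\<^bsub>G i\<^esub> x)]"]) auto
qed

lemma carrierE:
  assumes "P \<in> carrier (free_product I G)"
  obtains w where "w \<in> W" "P = R `` {w}"
  using assms by (auto simp: free_product_def elim: quotientE)

lemma one_class: "\<one>\<^bsub>free_product I G\<^esub> = R `` {[]}"
  by (simp add: free_product_def)

lemma group_free_product: "group (free_product I G)"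
proof (rule groupI)
  fix P Q S
  assume P: "P \<in> carrier (free_product I G)" and Q: "Q \<in> carrier (free_product I G)"
  then obtain p q where p: "p \<in> W" "P = R `` {p}" and q: "q \<in> W" "Q = R `` {q}"
    by (meson carrierE)
  then show "P \<otimes>\<^bsub>free_product I G\<^esub> Q \<in> carrier (free_product I G)"
    by (simp add: mult_class class_in_carrier)
  assume "S \<in> carrier (free_product I G)"
  then obtain s where "s \<in> W" "S = R `` {s}" by (meson carrierE)
  with p q show "P \<otimes>\<^bsub>free_product I G\<^esub> Q \<otimes>\<^bsub>free_product I G\<^esub> S =
      P \<otimes>\<^bsub>free_product I G\<^esub> (Q \<otimes>\<^bsub>free_product I G\<^esub> S)"
    by (simp add: mult_class)
next
  show "\<one>\<^bsub>free_product I G\<^esub> \<in> carrier (free_product I G)"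
    by (simp add: one_class class_in_carrier)
next
  fix P assume "P \<in> carrier (free_product I G)"
  then obtain p where p: "p \<in> W" "P = R `` {p}" by (meson carrierE)
  then show "\<one>\<^bsub>free_product I G\<^esub> \<otimes>\<^bsub>free_product I G\<^esub> P = P"
    using mult_class[of "[]" p] by (simp add: one_class)
  obtain v where v: "v \<in> W" "(v @ p, []) \<in> R" using left_inverse_word p by blast
  then have "(R `` {v}) \<otimes>\<^bsub>free_product I G\<^esub> P = \<one>\<^bsub>free_product I G\<^esub>"
    using p equiv_class_eq[OF equiv_rel v(2)] by (simp add: mult_class one_class)
  then show "\<exists>Q\<in>carrier (free_product I G). Q \<otimes>\<^bsub>free_product I G\<^esub> P = \<one>\<^bsub>free_product I G\<^esub>"
    using class_in_carrier[OF v(1)] by blast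
qed

text \<open>Universal property: homomorphisms on the factors extend to the free product.\<close>

lemma free_product_extend:
  fixes H (structure)
  assumes "group H" and f: "\<And>i. i \<in> I \<Longrightarrow> f i \<in> hom (G i) H"
  obtains h where "h \<in> hom (free_product I G) H"
    and "\<And>i x. i \<in> I \<Longrightarrow> x \<in> carrier (G i) \<Longrightarrow> h (R `` {[(i, x)]}) = f i x"
proof -
  interpret H: group H by fact
  define ev where "ev w = foldr (\<lambda>(i, x) y. f i x \<otimes> y) w \<one>" for w
  have ev_Nil: "ev [] = \<one>" and ev_Cons: "ev ((i, x) # w) = f i x \<otimes> ev w" for i x w
    by (simp_all add: ev_def)
  have fc: "f i x \<in> carrier H" if "i \<in> I" "x \<in> carrier (G i)" for i x
    using f[OF that(1)] that(2) by (auto simp: hom_def)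
  have evc: "ev w \<in> carrier H" if "w \<in> W" for w
    using that by (induction w) (auto simp: ev_Nil ev_Cons fc)
  have ev_app: "ev (v @ w) = ev v \<otimes> ev w" if "v \<in> W" "w \<in> W" for v w
    using that by (induction v) (auto simp: ev_Nil ev_Cons fc evc H.m_assoc)
  have f1: "f i \<one>\<^bsub>G i\<^esub> = \<one>" if "i \<in> I" for i
    using hom_one[OF f[OF that] group_factor[OF that] \<open>group H\<close>] .
  have ev_rel: "ev v = ev w" if "(v, w) \<in> R" for v w
    using that
  proof (induction rule: free_product_rel.induct)
    case (one u v i)
    then show ?case by (simp add: ev_app ev_Cons f1 evc one_factor)
  next
    case (mult u v i x y)
    then show ?case
      using f[OF mult(3)] by (simp add: ev_app ev_Cons evc mult_factor hom_def H.m_assoc fc)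
  qed auto
  define h where "h P = ev (SOME w. w \<in> P)" for P
  have h: "h (R `` {w}) = ev w" if "w \<in> W" for w
  proof -
    have "w \<in> R `` {w}" using that free_product_rel.refl by auto
    then have "(SOME v. v \<in> R `` {w}) \<in> R `` {w}" by (rule someI)
    then show ?thesis unfolding h_def using ev_rel by (metis Image_singleton_iff)
  qed
  show ?thesis
  proof
    show "h \<in> hom (free_product I G) H"
    proof (rule homI)
      fix P Q
      assume "P \<in> carrier (free_product I G)"
      then obtain p where p: "p \<in> W" "P = R `` {p}" by (rule carrierE)
      then show "h P \<in> carrier H" by (simp add: h evc)
      assume "Q \<in> carrier (free_product I G)"
      then obtain q where "q \<in> W" "Q = R `` {q}" by (rule carrierE)
      with p show "h (P \<otimes>\<^bsub>free_product I G\<^esub> Q) = h P \<otimes> h Q"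
        by (simp add: mult_class h ev_app)
    qed
    show "h (R `` {[(i, x)]}) = f i x" if "i \<in> I" "x \<in> carrier (G i)" for i x
      using that h[of "[(i, x)]"] by (simp add: ev_Cons ev_Nil fc)
  qed
qed

end

lemma group_free_power_C2: "group (free_power_C2 k)"
  unfolding free_power_C2_def
  by (rule group_family.group_free_product) (simp add: group_family_def)

lemma group_semidirect_product:
  assumes "group N" "group H"
    and hom: "\<And>g. g \<in> carrier H \<Longrightarrow> \<alpha> g \<in> hom N N"
    and one: "\<And>a. a \<in> carrier N \<Longrightarrow> \<alpha> \<one>\<^bsub>H\<^esub> a = a"
    and mult: "\<And>g h a. g \<in> carrier H \<Longrightarrow> h \<in> carrier H \<Longrightarrow> a \<in> carrier N
      \<Longrightarrow> \<alpha> (g \<otimes>\<^bsub>H\<^esub> h) a = \<alpha> g (\<alpha> h a)"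
  shows "group (semidirect_product N H \<alpha>)"
proof -
  interpret N: group N by fact
  interpret H: group H by fact
  have c: "\<alpha> g a \<in> carrier N" if "g \<in> carrier H" "a \<in> carrier N" for g a
    using hom that by (auto simp: hom_def)
  have m: "\<alpha> g (a \<otimes>\<^bsub>N\<^esub> b) = \<alpha> g a \<otimes>\<^bsub>N\<^esub> \<alpha> g b"
    if "g \<in> carrier H" "a \<in> carrier N" "b \<in> carrier N" for g a b
    using hom that by (auto simp: hom_def)
  show ?thesis
  proof (rule groupI)
    fix p assume "p \<in> carrier (semidirect_product N H \<alpha>)"
    then obtain a g where p: "p = (a, g)" "a \<in> carrier N" "g \<in> carrier H"
      by (auto simp: semidirect_product_def)
    let ?q = "(\<alpha> (inv\<^bsub>H\<^esub> g) (inv\<^bsub>N\<^esub> a), inv\<^bsub>H\<^esub> g)"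
    have "\<alpha> (inv\<^bsub>H\<^esub> g) (inv\<^bsub>N\<^esub> a) \<otimes>\<^bsub>N\<^esub> \<alpha> (inv\<^bsub>H\<^esub> g) a = \<one>\<^bsub>N\<^esub>"
      using p m[of "inv\<^bsub>H\<^esub> g" "inv\<^bsub>N\<^esub> a" a] hom_one[OF hom \<open>group N\<close> \<open>group N\<close>] by simp
    then have "?q \<otimes>\<^bsub>semidirect_product N H \<alpha>\<^esub> p = \<one>\<^bsub>semidirect_product N H \<alpha>\<^esub>"
      using p by (simp add: semidirect_product_def)
    moreover have "?q \<in> carrier (semidirect_product N H \<alpha>)"
      using p c by (simp add: semidirect_product_def)
    ultimately show "\<exists>q\<in>carrier (semidirect_product N H \<alpha>).
        q \<otimes>\<^bsub>semidirect_product N H \<alpha>\<^esub> p = \<one>\<^bsub>semidirect_product N H \<alpha>\<^esub>"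
      by blast
  qed (auto simp: semidirect_product_def c m one mult N.m_assoc H.m_assoc)
qed

lemma group_lamplighter_group:
  assumes "group_action G X \<phi>"
  shows "group (lamplighter_group G X \<phi>)"
proof -
  interpret group_action G X \<phi> by fact
  interpret G: group G using group_hom group_hom.axioms(1) by auto
  have inX: "\<phi> g q \<in> X" if "g \<in> carrier G" "q \<in> X" for g q
    using element_image that by blast
  have carrier: "carrier (lamp_group X) =
      {a \<in> X \<rightarrow>\<^sub>E {0..<2}. finite {q \<in> X. a q \<noteq> 0}}"
    by (subst carrier_sum_group) (auto simp: carrier_integer_mod_group)
  have closed: "permute_lamps G X \<phi> g a \<in> carrier (lamp_group X)"
    if g: "g \<in> carrier G" and a: "a \<in> carrier (lamp_group X)" for g a
  proof -
    have "{q \<in> X. a (\<phi> (inv\<^bsub>G\<^esub> g) q) \<noteq> 0} \<subseteq> \<phi> g ` {q \<in> X. a q \<noteq> 0}"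
    proof
      fix q assume q: "q \<in> {q \<in> X. a (\<phi> (inv\<^bsub>G\<^esub> g) q) \<noteq> 0}"
      then have "\<phi> g (\<phi> (inv\<^bsub>G\<^esub> g) q) = q"
        using orbit_sym_aux[of "inv\<^bsub>G\<^esub> g" q] g by simp
      then show "q \<in> \<phi> g ` {q \<in> X. a q \<noteq> 0}"
        using q inX[of "inv\<^bsub>G\<^esub> g" q] g by (metis (mono_tags, lifting) G.inv_closed imageI mem_Collect_eq)
    qed
    moreover have "{q \<in> X. permute_lamps G X \<phi> g a q \<noteq> 0} = {q \<in> X. a (\<phi> (inv\<^bsub>G\<^esub> g) q) \<noteq> 0}"
      by (auto simp: permute_lamps_def)
    ultimately have "finite {q \<in> X. permute_lamps G X \<phi> g a q \<noteq> 0}"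
      using a unfolding carrier by (simp add: finite_subset)
    then show ?thesis
      using g a inX[of "inv\<^bsub>G\<^esub> g"] unfolding carrier by (auto simp: permute_lamps_def PiE_iff)
  qed
  show ?thesis unfolding lamplighter_group_def
  proof (rule group_semidirect_product)
    show "group (lamp_group X)" by simp
    show "group G" by (rule G.is_group)
    show "permute_lamps G X \<phi> g \<in> hom (lamp_group X) (lamp_group X)" if "g \<in> carrier G" for g
    proof (rule homI)
      fix a b
      assume "a \<in> carrier (lamp_group X)" "b \<in> carrier (lamp_group X)"
      show "permute_lamps G X \<phi> g (a \<otimes>\<^bsub>lamp_group X\<^esub> b) =
          permute_lamps G X \<phi> g a \<otimes>\<^bsub>lamp_group X\<^esub> permute_lamps G X \<phi> g b"
        using that inX[of "inv\<^bsub>G\<^esub> g"] by (auto simp: permute_lamps_def)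
    qed (rule closed[OF that])
    show "permute_lamps G X \<phi> \<one>\<^bsub>G\<^esub> a = a" if "a \<in> carrier (lamp_group X)" for a
    proof
      fix q
      show "permute_lamps G X \<phi> \<one>\<^bsub>G\<^esub> a q = a q"
        using that unfolding carrier
        by (cases "q \<in> X") (auto simp: permute_lamps_def id_eq_one[symmetric] PiE_iff extensional_def)
    qed
    show "permute_lamps G X \<phi> (g \<otimes>\<^bsub>G\<^esub> h) a = permute_lamps G X \<phi> g (permute_lamps G X \<phi> h a)"
      if "g \<in> carrier G" "h \<in> carrier G" "a \<in> carrier (lamp_group X)" for g h a
      using that inX[of "inv\<^bsub>G\<^esub> g"]
      by (auto simp: permute_lamps_def G.inv_mult_group composition_rule)
  qed
qed

end

theory Submission
  imports Defs
begin

text \<open>Replace each generating involution of the action by its truncation to a finite set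
  \<open>Y \<subseteq> X\<close>, which fixes the points of \<open>Y\<close> whose image leaves \<open>Y\<close>. A truncated involution is
  again an involution, so the free product acts on \<open>Y\<close>, and if \<open>Y\<close> contains the trajectories of
  finitely many points under finitely many words, then on these points the new action agrees with
  the old one. Restricting lamp configurations to such a \<open>Y\<close> gives a local embedding of the
  lamplighter group into the finite group \<open>(\<int>/2)\<^sup>Y \<rtimes> Sym Y\<close>, and a finite group acts
  freely on itself by left multiplication.\<close>

section \<open>From local embeddings into finite groups to LEF\<close>

text \<open>As in Cayley's theorem, \<open>H\<close> acts on itself by left translation, and the
  bijection \<open>e\<close> with inverse \<open>d\<close> carries this action to a finite set of
  naturals. Translation by a nontrivial element fixes no point, so its Hamming distance from the
  identity is exactly 1.\<close>

lemma LEF_if_locally_embeds_in_finite_groups: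
  assumes "group G"
    and embed: "\<And>F. finite F \<Longrightarrow> F \<subseteq> carrier G \<Longrightarrow>
      \<exists>(H :: 'h monoid) \<theta>. group H \<and> finite (carrier H) \<and> \<theta> \<in> carrier G \<rightarrow> carrier H \<and>
        (\<forall>f\<in>F. \<forall>g\<in>F. \<theta> (f \<otimes>\<^bsub>G\<^esub> g) = \<theta> f \<otimes>\<^bsub>H\<^esub> \<theta> g) \<and>
        (\<forall>f\<in>F. f \<noteq> \<one>\<^bsub>G\<^esub> \<longrightarrow> \<theta> f \<noteq> \<one>\<^bsub>H\<^esub>) \<and> \<theta> \<one>\<^bsub>G\<^esub> = \<one>\<^bsub>H\<^esub>"
  shows "LEF G"
  unfolding LEF_def
proof (intro conjI allI impI)
  fix F and \<epsilon> :: real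
  assume F: "finite F \<and> F \<subseteq> carrier G \<and> 0 < \<epsilon>"
  then obtain H :: "'h monoid" and \<theta> where "group H" and fin: "finite (carrier H)"
    and \<theta>: "\<theta> \<in> carrier G \<rightarrow> carrier H"
    and mult: "\<And>f g. f \<in> F \<Longrightarrow> g \<in> F \<Longrightarrow> \<theta> (f \<otimes>\<^bsub>G\<^esub> g) = \<theta> f \<otimes>\<^bsub>H\<^esub> \<theta> g"
    and ne: "\<And>f. f \<in> F \<Longrightarrow> f \<noteq> \<one>\<^bsub>G\<^esub> \<Longrightarrow> \<theta> f \<noteq> \<one>\<^bsub>H\<^esub>"
    and one: "\<theta> \<one>\<^bsub>G\<^esub> = \<one>\<^bsub>H\<^esub>"
    using embed[of F] by auto
  interpret H: group H by fact
  obtain e :: "'h \<Rightarrow> nat" and A where e: "bij_betw e (carrier H) A" and "finite A"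
    using fin by (metis bij_betw_finite ex_bij_betw_finite_nat)
  define d where "d = inv_into (carrier H) e"
  have eA: "e x \<in> A" if "x \<in> carrier H" for x
    using e that bij_betwE by fast
  have dH: "d m \<in> carrier H" and ed: "e (d m) = m" if "m \<in> A" for m
    using e that unfolding d_def
    by (auto simp: bij_betw_inv_into_right bij_betw_def inv_into_into)
  have de: "d (e x) = x" if "x \<in> carrier H" for x
    using e that unfolding d_def by (simp add: bij_betw_inv_into_left)
  have \<theta>H: "\<theta> f \<in> carrier H" if "f \<in> carrier G" for f
    using \<theta> that by auto
  have FH: "\<theta> f \<in> carrier H" if "f \<in> F" for f
    using F \<theta>H that by auto
  define \<Theta> where "\<Theta> f = (\<lambda>m\<in>A. e (\<theta> f \<otimes>\<^bsub>H\<^esub> d m))" for f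
  have "A \<noteq> {}" using eA[OF H.one_closed] by auto
  moreover have "\<Theta> \<in> carrier G \<rightarrow> (A \<rightarrow>\<^sub>E A)"
    by (auto simp: \<Theta>_def \<theta>H dH eA)
  moreover have "\<Theta> (f \<otimes>\<^bsub>G\<^esub> g) = compose A (\<Theta> f) (\<Theta> g)" if "f \<in> F" "g \<in> F" for f g
    using that by (auto simp: \<Theta>_def compose_def fun_eq_iff mult FH dH eA de H.m_assoc)
  moreover have "hamming_dist A (\<Theta> f) (\<lambda>x\<in>A. x) > 1 - \<epsilon>" if f: "f \<in> F" "f \<noteq> \<one>\<^bsub>G\<^esub>" for f
  proof -
    have "\<Theta> f m \<noteq> m" if m: "m \<in> A" for m
    proof
      assume "\<Theta> f m = m"
      then have "d (e (\<theta> f \<otimes>\<^bsub>H\<^esub> d m)) = d m" using m by (simp add: \<Theta>_def)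
      then have "\<theta> f \<otimes>\<^bsub>H\<^esub> d m = d m" using f m by (simp add: de FH dH)
      then show False using ne[OF f] FH[OF f(1)] dH[OF m] by simp
    qed
    then have "{x \<in> A. \<Theta> f x \<noteq> (\<lambda>x\<in>A. x) x} = A" by auto
    then show ?thesis
      using F \<open>finite A\<close> \<open>A \<noteq> {}\<close> by (simp add: hamming_dist_def)
  qed
  moreover have "\<Theta> \<one>\<^bsub>G\<^esub> = (\<lambda>x\<in>A. x)"
    by (auto simp: \<Theta>_def one dH ed)
  ultimately show "\<exists>(A :: nat set) \<Theta>. finite A \<and> A \<noteq> {} \<and> \<Theta> \<in> carrier G \<rightarrow> (A \<rightarrow>\<^sub>E A) \<and>
      (\<forall>f\<in>F. \<forall>g\<in>F. f \<otimes>\<^bsub>G\<^esub> g \<in> F \<longrightarrow> \<Theta> (f \<otimes>\<^bsub>G\<^esub> g) = compose A (\<Theta> f) (\<Theta> g)) \<and>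
      (\<forall>f\<in>F. f \<noteq> \<one>\<^bsub>G\<^esub> \<longrightarrow> hamming_dist A (\<Theta> f) (\<lambda>x\<in>A. x) > 1 - \<epsilon>) \<and>
      \<Theta> \<one>\<^bsub>G\<^esub> = (\<lambda>x\<in>A. x)"
    using \<open>finite A\<close> by (intro exI[of _ A] exI[of _ \<Theta>]) auto
qed fact

section \<open>Finiteness of lamplighter groups over finite sets\<close>

lemma carrier_lamp_group:
  "carrier (lamp_group X) = {a \<in> X \<rightarrow>\<^sub>E {0..<2}. finite {q \<in> X. a q \<noteq> 0}}"
  by (subst carrier_sum_group) (auto simp: carrier_integer_mod_group)

lemma group_action_BijGroup: "group_action (BijGroup Y) Y (\<lambda>p. p)"
  by (simp add: group_action_def group_hom_def group_hom_axioms_def group_BijGroup hom_def)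

lemma finite_carrier_BijGroup: "finite Y \<Longrightarrow> finite (carrier (BijGroup Y))"
  by (rule finite_subset[of _ "Y \<rightarrow>\<^sub>E Y"])
     (auto simp: BijGroup_def Bij_def bij_betw_def finite_PiE extensional_def PiE_iff)

lemma finite_carrier_lamplighter_group:
  assumes "finite Y" "finite (carrier G)"
  shows "finite (carrier (lamplighter_group G Y \<phi>))"
proof -
  have "finite (carrier (lamp_group Y))"
    unfolding carrier_lamp_group using assms by (simp add: finite_PiE)
  with assms show ?thesis
    by (simp add: lamplighter_group_def semidirect_product_def)
qed

section \<open>From finite approximations of the action to the lamplighter group\<close>

text \<open>Each \<pi> from \<open>approx\<close> is a homomorphism on all of \<open>G\<close>, so
  the group component of the local embedding is multiplicative everywhere. Only the lamp component
  relies on the agreement of \<pi> and \<phi> near the lit lamps.\<close>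

lemma LEF_lamplighter_group:
  fixes X :: "'x set"
  assumes "faithful_action G X \<phi>"
    and approx: "\<And>K S. finite K \<Longrightarrow> K \<subseteq> carrier G \<Longrightarrow> finite S \<Longrightarrow> S \<subseteq> X \<Longrightarrow>
      \<exists>Y \<pi>. finite Y \<and> S \<subseteq> Y \<and> Y \<subseteq> X \<and> \<pi> \<in> hom G (BijGroup Y) \<and>
        (\<forall>g\<in>K. \<forall>q\<in>S. \<pi> g q = \<phi> g q)"
  shows "LEF (lamplighter_group G X \<phi>)"
proof (rule LEF_if_locally_embeds_in_finite_groups)
  interpret faithful_action G X \<phi> by fact
  interpret G: group G using group_hom group_hom.axioms(1) by auto
  let ?L = "lamplighter_group G X \<phi>"
  show "group ?L"
    by (rule group_lamplighter_group) (rule group_action_axioms)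
  fix F assume "finite F" and F: "F \<subseteq> carrier ?L"
  \<comment> \<open>Faithfulness is injectivity of \<phi>. Since \<open>\<phi> g\<close> is
    extensional, fixing every point of \<open>X\<close> makes it the unit of the bijection
    group.\<close>
  have moved: "\<exists>q\<in>X. \<phi> g q \<noteq> q" if g: "g \<in> carrier G" "g \<noteq> \<one>\<^bsub>G\<^esub>" for g
  proof (rule ccontr)
    assume *: "\<not> ?thesis"
    have "\<phi> g \<in> extensional X" using bij_prop0[OF g(1)] by (simp add: Bij_def)
    with * have "\<phi> g = (\<lambda>x\<in>X. x)" by (auto simp: extensional_def fun_eq_iff)
    then have "g = \<one>\<^bsub>G\<^esub>"
      using faithful g(1) by (simp add: id_eq_one inj_on_eq_iff)
    with g(2) show False by simp
  qed
  define m where "m g = (SOME q. q \<in> X \<and> \<phi> g q \<noteq> q)" for g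
  have m: "m g \<in> X" "\<phi> g (m g) \<noteq> m g" if "g \<in> carrier G" "g \<noteq> \<one>\<^bsub>G\<^esub>" for g
    using someI_ex[of "\<lambda>q. q \<in> X \<and> \<phi> g q \<noteq> q"] moved[OF that] unfolding m_def by blast+
  have FD: "a \<in> carrier (lamp_group X)" "g \<in> carrier G" if "(a, g) \<in> F" for a g
    using F that by (auto simp: lamplighter_group_def semidirect_product_def)
  \<comment> \<open>The supports of the lamp configurations serve multiplicativity and keep every
    lit lamp inside \<open>Y\<close>. The witnesses \<open>m g\<close> ensure that nontrivial group
    components stay nontrivial under \<pi>.\<close>
  define S where
    "S = (\<Union>(a, g)\<in>F. {q \<in> X. a q \<noteq> 0}) \<union> m ` (snd ` F - {\<one>\<^bsub>G\<^esub>})"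
  have "finite S"
  proof -
    have "finite {q \<in> X. a q \<noteq> 0}" if "(a, g) \<in> F" for a g
      using FD(1)[OF that] by (simp add: carrier_lamp_group)
    then show ?thesis
      using \<open>finite F\<close> by (auto simp: S_def)
  qed
  have "S \<subseteq> X"
  proof -
    have "m g \<in> X" if "g \<in> snd ` F" "g \<noteq> \<one>\<^bsub>G\<^esub>" for g
      using that m(1)[of g] FD(2) by auto
    then show ?thesis by (auto simp: S_def)
  qed
  obtain Y \<pi> where Y: "finite Y" "S \<subseteq> Y" "Y \<subseteq> X" and \<pi>: "\<pi> \<in> hom G (BijGroup Y)"
    and agree: "\<And>g q. g \<in> snd ` F \<Longrightarrow> q \<in> S \<Longrightarrow> \<pi> g q = \<phi> g q"
  proof -
    have "finite (snd ` F)" "snd ` F \<subseteq> carrier G"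
      using \<open>finite F\<close> FD(2) by auto
    then show ?thesis
      using approx[of "snd ` F" S] that \<open>finite S\<close> \<open>S \<subseteq> X\<close> by blast
  qed
  have act: "group_action G Y \<pi>"
    using \<pi> by (simp add: group_action_def group_hom_def group_hom_axioms_def group_BijGroup)
  interpret Y: group_action G Y \<pi> by (rule act)
  interpret B: group_hom G "BijGroup Y" \<pi> by (rule Y.group_hom)
  let ?H = "lamplighter_group (BijGroup Y) Y (\<lambda>p. p)"
  define \<theta> where "\<theta> = (\<lambda>(a :: 'x \<Rightarrow> int, g). (restrict a Y, \<pi> g))"
  have "group ?H"
    by (rule group_lamplighter_group) (rule group_action_BijGroup)
  moreover have "finite (carrier ?H)"
    using Y(1) by (simp add: finite_carrier_lamplighter_group finite_carrier_BijGroup)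
  moreover have "\<theta> \<in> carrier ?L \<rightarrow> carrier ?H"
    using Y by (auto simp: \<theta>_def lamplighter_group_def semidirect_product_def carrier_lamp_group
        PiE_iff subset_iff)
  moreover have "\<theta> \<one>\<^bsub>?L\<^esub> = \<one>\<^bsub>?H\<^esub>"
    using Y(3) by (auto simp: \<theta>_def lamplighter_group_def semidirect_product_def fun_eq_iff
        restrict_def)
  moreover have "\<theta> f \<noteq> \<one>\<^bsub>?H\<^esub>" if f: "f \<in> F" "f \<noteq> \<one>\<^bsub>?L\<^esub>" for f
  proof
    assume eq: "\<theta> f = \<one>\<^bsub>?H\<^esub>"
    obtain a g where ag: "f = (a, g)" by fastforce
    with f(1) have a: "a \<in> carrier (lamp_group X)" and g: "g \<in> carrier G"
      using FD by auto
    from eq ag have a0: "restrict a Y = (\<lambda>q\<in>Y. 0)" and g1: "\<pi> g = (\<lambda>q\<in>Y. q)"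
      by (auto simp: \<theta>_def lamplighter_group_def semidirect_product_def BijGroup_def)
    \<comment> \<open>A nontrivial pair has either a nontrivial group component, detected at
      \<open>m g\<close>, or a lit lamp, detected at a point of its support. Both points lie in
      \<open>S\<close>, hence in \<open>Y\<close>.\<close>
    show False
    proof (cases "g = \<one>\<^bsub>G\<^esub>")
      case True
      with f(2) ag have "a \<noteq> (\<lambda>q\<in>X. 0)"
        by (auto simp: lamplighter_group_def semidirect_product_def)
      with a obtain q where "q \<in> X" "a q \<noteq> 0"
        unfolding carrier_lamp_group
        by (auto simp: PiE_iff extensional_def fun_eq_iff split: if_splits)
      moreover from this have "q \<in> Y"
        using f(1) ag Y(2) by (force simp: S_def)
      ultimately show False using fun_cong[OF a0, of q] by simp
    next
      case False
      then have "m g \<in> S" using f(1) ag by (force simp: S_def)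
      then show False
        using agree[of g "m g"] m(2)[OF g False] f(1) ag g1 Y(2) by force
    qed
  qed
  moreover have "\<theta> (f \<otimes>\<^bsub>?L\<^esub> h) = \<theta> f \<otimes>\<^bsub>?H\<^esub> \<theta> h" if f: "f \<in> F" and h: "h \<in> F" for f h
  proof -
    obtain a g where ag: "f = (a, g)" by fastforce
    obtain b u where bu: "h = (b, u)" by fastforce
    have g: "g \<in> carrier G" "g \<in> snd ` F" and u: "u \<in> carrier G"
      using f h FD ag bu by force+
    have supp: "b q = 0" if "q \<in> X" "q \<notin> S" for q
      using h bu that by (auto simp: S_def)
    \<comment> \<open>Agreement is known for \<open>g\<close> on \<open>S\<close>, but not for its
      inverse. So the two preimages of \<open>q\<close>, under \<open>\<phi> g\<close> and under
      \<open>\<pi> g\<close>, are compared: if either lies in \<open>S\<close>, both maps send it to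
      \<open>q\<close> and injectivity makes the preimages equal; otherwise \<open>b\<close>
      vanishes at both.\<close>
    have "b (\<phi> (inv\<^bsub>G\<^esub> g) q) = b (\<pi> (inv\<^bsub>G\<^esub> g) q)" if q: "q \<in> Y" for q
    proof -
      let ?p = "\<phi> (inv\<^bsub>G\<^esub> g) q" and ?p' = "\<pi> (inv\<^bsub>G\<^esub> g) q"
      have p: "?p \<in> X" "\<phi> g ?p = q" and p': "?p' \<in> Y" "\<pi> g ?p' = q"
        using q Y(3) g element_image[of "inv\<^bsub>G\<^esub> g" q] orbit_sym_aux[of "inv\<^bsub>G\<^esub> g" q]
          Y.element_image[of "inv\<^bsub>G\<^esub> g" q] Y.orbit_sym_aux[of "inv\<^bsub>G\<^esub> g" q] by auto
      show ?thesis
      proof (cases "?p \<in> S \<or> ?p' \<in> S")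
        case True
        then have "?p = ?p'"
        proof
          assume "?p \<in> S"
          then have "\<pi> g ?p = q" using agree[OF g(2)] p by simp
          then show ?thesis
            using Y.orbit_sym_aux[OF g(1)] \<open>?p \<in> S\<close> Y(2) by (metis subsetD)
        next
          assume "?p' \<in> S"
          then have "\<phi> g ?p' = q" using agree[OF g(2)] p' by simp
          then show ?thesis
            using orbit_sym_aux[OF g(1)] p'(1) Y(3) by (metis subsetD)
        qed
        then show ?thesis by simp
      next
        case False
        then show ?thesis using supp p(1) p'(1) Y(3) by (metis subsetD)
      qed
    qed
    moreover have "\<pi> (inv\<^bsub>G\<^esub> g) q \<in> Y" if "q \<in> Y" for q
      by (rule Y.element_image[OF G.inv_closed[OF g(1)] that HOL.refl])
    \<comment> \<open>The product in \<open>?H\<close> twists the lamps by the inverse of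
      \<open>\<pi> g\<close> in \<open>BijGroup Y\<close>. Using \<open>B.hom_inv\<close> backwards
      turns this into \<pi> applied to the inverse of \<open>g\<close>, the form compared
      above.\<close>
    ultimately show ?thesis
      using Y(3) g u
      by (auto simp: ag bu \<theta>_def lamplighter_group_def semidirect_product_def permute_lamps_def
          fun_eq_iff B.hom_inv[symmetric] subset_iff simp del: B.hom_inv)
  qed
  ultimately show "\<exists>(H :: (('x \<Rightarrow> int) \<times> ('x \<Rightarrow> 'x)) monoid) \<theta>. group H \<and> finite (carrier H) \<and>
      \<theta> \<in> carrier ?L \<rightarrow> carrier H \<and>
      (\<forall>f\<in>F. \<forall>g\<in>F. \<theta> (f \<otimes>\<^bsub>?L\<^esub> g) = \<theta> f \<otimes>\<^bsub>H\<^esub> \<theta> g) \<and>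
      (\<forall>f\<in>F. f \<noteq> \<one>\<^bsub>?L\<^esub> \<longrightarrow> \<theta> f \<noteq> \<one>\<^bsub>H\<^esub>) \<and> \<theta> \<one>\<^bsub>?L\<^esub> = \<one>\<^bsub>H\<^esub>"
    by (intro exI[of _ ?H] exI[of _ \<theta>]) auto
qed

section \<open>Homomorphisms from the two-element group and truncated involutions\<close>

lemma hom_C2_of_involution:
  assumes "group H" "t \<in> carrier H" "t \<otimes>\<^bsub>H\<^esub> t = \<one>\<^bsub>H\<^esub>"
  shows "(\<lambda>x. if x = 0 then \<one>\<^bsub>H\<^esub> else t) \<in> hom (integer_mod_group 2) H"
proof -
  interpret group H by fact
  have bit: "x = 0 \<or> x = 1" if "x \<in> carrier (integer_mod_group 2)" for x
    using that by (auto simp: carrier_integer_mod_group)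
  show ?thesis
  proof (rule homI)
    fix x y assume "x \<in> carrier (integer_mod_group 2)" "y \<in> carrier (integer_mod_group 2)"
    then have "x = 0 \<or> x = 1" "y = 0 \<or> y = 1" by (simp_all add: bit)
    then show "(if x \<otimes>\<^bsub>integer_mod_group 2\<^esub> y = 0 then \<one>\<^bsub>H\<^esub> else t) =
        (if x = 0 then \<one>\<^bsub>H\<^esub> else t) \<otimes>\<^bsub>H\<^esub> (if y = 0 then \<one>\<^bsub>H\<^esub> else t)"
      using assms by (elim disjE) simp_all
  qed (simp add: assms)
qed

text \<open>A point whose image leaves \<open>Y\<close> becomes fixed, and the remaining points are
  fixed or swapped in pairs within \<open>Y\<close>. Hence \<open>t'\<close> is its own inverse,
  which also gives its bijectivity.\<close>

lemma truncated_involution: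
  assumes t: "\<And>y. y \<in> Y \<Longrightarrow> t y \<in> Y \<Longrightarrow> t (t y) = y"
  defines "t' \<equiv> (\<lambda>y\<in>Y. if t y \<in> Y then t y else y)"
  shows "t' \<in> carrier (BijGroup Y)" "t' \<otimes>\<^bsub>BijGroup Y\<^esub> t' = \<one>\<^bsub>BijGroup Y\<^esub>"
proof -
  have inv: "t' (t' y) = y" "t' y \<in> Y" if "y \<in> Y" for y
    using that t by (auto simp: t'_def)
  have "bij_betw t' Y Y"
    by (rule bij_betw_byWitness[where f' = t']) (auto simp: inv)
  then show "t' \<in> carrier (BijGroup Y)"
    by (simp add: BijGroup_def Bij_def t'_def)
  then show "t' \<otimes>\<^bsub>BijGroup Y\<^esub> t' = \<one>\<^bsub>BijGroup Y\<^esub>"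
    by (auto simp: BijGroup_def compose_def fun_eq_iff inv)
qed

section \<open>Finite approximations of actions of the free power\<close>

locale free_power_C2_action =
  fixes k :: nat and X :: "'x set" and \<phi>
  assumes action: "group_action (free_power_C2 k) X \<phi>"
begin

sublocale group_action "free_power_C2 k" X \<phi> by (rule action)

sublocale C2: group_family "{..<k}" "\<lambda>_. integer_mod_group 2"
  by (rule group_family.intro) simp

abbreviation cls :: "(nat \<times> int) list \<Rightarrow> (nat \<times> int) list set"
  where "cls w \<equiv> C2.R `` {w}"

text \<open>Agreement is demanded only for single letters and only where the image stays in
  \<open>Y\<close>: this is all that truncation preserves, and it propagates to words whose
  trajectory stays in \<open>Y\<close>.\<close>

definition extends_letters :: "'x set \<Rightarrow> ((nat \<times> int) list set \<Rightarrow> 'x \<Rightarrow> 'x) \<Rightarrow> bool"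
  where "extends_letters Y \<pi> \<longleftrightarrow> \<pi> \<in> hom (free_power_C2 k) (BijGroup Y) \<and>
    (\<forall>i<k. \<forall>x\<in>{0..<2}. \<forall>y\<in>Y. \<phi> (cls [(i, x)]) y \<in> Y \<longrightarrow> \<pi> (cls [(i, x)]) y = \<phi> (cls [(i, x)]) y)"

lemma cls_closed: "w \<in> C2.W \<Longrightarrow> cls w \<in> carrier (free_power_C2 k)"
  by (simp add: free_power_C2_def C2.class_in_carrier)

lemma cls_Cons:
  assumes "i < k" "x \<in> {0..<2}" "w \<in> C2.W"
  shows "cls ((i, x) # w) = cls [(i, x)] \<otimes>\<^bsub>free_power_C2 k\<^esub> cls w"
  using assms C2.mult_class[of "[(i, x)]" w]
  by (simp add: free_power_C2_def carrier_integer_mod_group)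

text \<open>Words need not be reduced and may contain identity letters, so these are treated
  alongside the generators.\<close>

lemma action_letter_zero:
  assumes "i < k" "y \<in> X"
  shows "\<phi> (cls [(i, 0)]) y = y"
proof -
  have "cls [(i, 0)] = cls []"
    using free_product_rel.one[of "[]" "{..<k}" "\<lambda>_. integer_mod_group 2" "[]" i] assms(1)
    by (intro equiv_class_eq[OF C2.equiv_rel]) simp
  then have "cls [(i, 0)] = \<one>\<^bsub>free_power_C2 k\<^esub>"
    by (simp add: free_power_C2_def C2.one_class)
  then show ?thesis
    using assms(2) by (simp add: id_eq_one[symmetric])
qed

lemma action_letter_involution:
  assumes "i < k" "y \<in> X"
  shows "\<phi> (cls [(i, 1)]) (\<phi> (cls [(i, 1)]) y) = y"
proof -
  have "cls [(i, 1), (i, 1)] = cls [(i, 0)]"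
    using free_product_rel.mult[of "[]" "{..<k}" "\<lambda>_. integer_mod_group 2" "[]" i 1 1] assms(1)
    by (intro equiv_class_eq[OF C2.equiv_rel]) simp
  then have "\<phi> (cls [(i, 1)] \<otimes>\<^bsub>free_power_C2 k\<^esub> cls [(i, 1)]) y = y"
    using assms cls_Cons[of i 1 "[(i, 1)]"] action_letter_zero
    by (simp add: carrier_integer_mod_group)
  then show ?thesis
    using assms composition_rule[of y "cls [(i, 1)]" "cls [(i, 1)]"]
    by (simp add: cls_closed carrier_integer_mod_group)
qed

text \<open>Freeness enters here: by the universal property \<open>C2.free_product_extend\<close>,
  any choice of one involution of \<open>Y\<close> per factor extends to a homomorphism. Truncation
  alters a generator only where its image leaves \<open>Y\<close>, exactly where
  \<open>extends_letters\<close> demands nothing.\<close>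

lemma ex_extends_letters:
  assumes "Y \<subseteq> X"
  shows "\<exists>\<pi>. extends_letters Y \<pi>"
proof -
  define t where "t i = (\<lambda>y\<in>Y. if \<phi> (cls [(i, 1)]) y \<in> Y then \<phi> (cls [(i, 1)]) y else y)" for i
  have "(\<lambda>x. if x = 0 then \<one>\<^bsub>BijGroup Y\<^esub> else t i) \<in> hom (integer_mod_group 2) (BijGroup Y)"
    if "i \<in> {..<k}" for i
    unfolding t_def using that assms action_letter_involution
    by (intro hom_C2_of_involution group_BijGroup truncated_involution) auto
  then obtain \<pi> where "\<pi> \<in> hom (free_power_C2 k) (BijGroup Y)"
    and \<pi>: "\<And>i x. i < k \<Longrightarrow> x \<in> {0..<2} \<Longrightarrow>
      \<pi> (cls [(i, x)]) = (if x = 0 then \<one>\<^bsub>BijGroup Y\<^esub> else t i)"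
    using C2.free_product_extend[OF group_BijGroup[of Y],
        of "\<lambda>i x. if x = 0 then \<one>\<^bsub>BijGroup Y\<^esub> else t i"]
    by (auto simp: free_power_C2_def carrier_integer_mod_group)
  moreover have "\<pi> (cls [(i, x)]) y = \<phi> (cls [(i, x)]) y"
    if "i < k" "x \<in> {0..<2}" "y \<in> Y" "\<phi> (cls [(i, x)]) y \<in> Y" for i x y
  proof (cases "x = 0")
    case True
    then show ?thesis
      using that assms \<pi>[of i x] action_letter_zero[of i y] by (auto simp: BijGroup_def)
  next
    case False
    with that(2) have "x = 1" by auto
    then show ?thesis using that \<pi>[of i x] by (simp add: t_def)
  qed
  ultimately show ?thesis
    unfolding extends_letters_def by blast
qed

text \<open>Letters act from the right end of the word, so \<open>P\<close> collects the images of
  \<open>q\<close> under all suffixes. It is chosen before \<open>Y\<close> and \<pi>, so that a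
  single \<open>Y\<close> can later serve many words and points.\<close>

lemma agree_along_trajectory:
  assumes "w \<in> C2.W" "q \<in> X"
  shows "\<exists>P. finite P \<and> P \<subseteq> X \<and>
    (\<forall>Y \<pi>. P \<subseteq> Y \<longrightarrow> extends_letters Y \<pi> \<longrightarrow> \<pi> (cls w) q = \<phi> (cls w) q)"
  using assms(1)
proof (induction w)
  case Nil
  \<comment> \<open>The unit of \<open>BijGroup Y\<close> is the identity only on \<open>Y\<close>,
    hence \<open>q\<close> itself must belong to \<open>Y\<close>.\<close>
  have "\<pi> (cls []) q = \<phi> (cls []) q" if "{q} \<subseteq> Y" "extends_letters Y \<pi>" for Y \<pi>
  proof -
    have "\<pi> \<one>\<^bsub>free_power_C2 k\<^esub> = \<one>\<^bsub>BijGroup Y\<^esub>"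
      using that(2) hom_one[OF _ group_free_power_C2 group_BijGroup]
      by (auto simp: extends_letters_def)
    moreover have "cls [] = \<one>\<^bsub>free_power_C2 k\<^esub>"
      by (simp add: free_power_C2_def C2.one_class)
    ultimately show ?thesis
      using that(1) assms(2) by (simp add: id_eq_one[symmetric] BijGroup_def)
  qed
  then show ?case using assms(2) by (intro exI[of _ "{q}"]) auto
next
  case (Cons l w)
  obtain i x where l: "l = (i, x)" by fastforce
  with Cons.prems have ix: "i < k" "x \<in> {0..<2}" and w: "w \<in> C2.W"
    by (auto simp: carrier_integer_mod_group)
  have lc: "cls [(i, x)] \<in> carrier (free_power_C2 k)"
    using ix by (intro cls_closed) (simp add: carrier_integer_mod_group)
  obtain P where P: "finite P" "P \<subseteq> X"
    and IH: "\<And>Y \<pi>. P \<subseteq> Y \<Longrightarrow> extends_letters Y \<pi> \<Longrightarrow> \<pi> (cls w) q = \<phi> (cls w) q"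
    using Cons.IH[OF w] by blast
  let ?p = "\<phi> (cls w) q" and ?r = "\<phi> (cls (l # w)) q"
  have p: "?p \<in> X" and r: "?r \<in> X"
    using element_image[OF cls_closed assms(2)] w Cons.prems by blast+
  have r_eq: "?r = \<phi> (cls [(i, x)]) ?p"
    using cls_Cons[OF ix w] composition_rule[OF assms(2) lc cls_closed[OF w]] l by simp
  \<comment> \<open>\<open>P\<close> feeds the induction hypothesis, \<open>q\<close> the
    composition rule on \<open>Y\<close>, and \<open>?p\<close> and \<open>?r\<close> are the two
    ends of the new step, where the letter must not be truncated.\<close>
  have "\<pi> (cls (l # w)) q = ?r" if Y: "insert q (insert ?p (insert ?r P)) \<subseteq> Y"
    and \<pi>: "extends_letters Y \<pi>" for Y \<pi>
  proof -
    interpret Y: group_action "free_power_C2 k" Y \<pi>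
      using \<pi> by (simp add: extends_letters_def group_action_def group_hom_def
          group_hom_axioms_def group_BijGroup group_free_power_C2)
    have "\<pi> (cls (l # w)) q = \<pi> (cls [(i, x)]) (\<pi> (cls w) q)"
      using cls_Cons[OF ix w] Y.composition_rule[OF _ lc cls_closed[OF w], of q] l Y by simp
    also have "\<dots> = \<pi> (cls [(i, x)]) ?p" using IH[OF _ \<pi>] Y by simp
    also have "\<dots> = ?r" using \<pi> ix Y r_eq by (simp add: extends_letters_def)
    finally show ?thesis .
  qed
  then show ?case
    using P p r assms(2) by (intro exI[of _ "insert q (insert ?p (insert ?r P))"]) auto
qed

lemma ex_finite_approximation:
  assumes "finite K" "K \<subseteq> carrier (free_power_C2 k)" "finite S" "S \<subseteq> X"
  shows "\<exists>Y \<pi>. finite Y \<and> S \<subseteq> Y \<and> Y \<subseteq> X \<and> \<pi> \<in> hom (free_power_C2 k) (BijGroup Y) \<and>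
    (\<forall>g\<in>K. \<forall>q\<in>S. \<pi> g q = \<phi> g q)"
proof -
  have "\<forall>gq\<in>K \<times> S. \<exists>P. finite P \<and> P \<subseteq> X \<and> (\<forall>Y \<pi>. P \<subseteq> Y \<longrightarrow> extends_letters Y \<pi> \<longrightarrow>
      \<pi> (fst gq) (snd gq) = \<phi> (fst gq) (snd gq))"
  proof
    fix gq assume "gq \<in> K \<times> S"
    then have "fst gq \<in> carrier (free_product {..<k} (\<lambda>_. integer_mod_group 2))" "snd gq \<in> X"
      using assms by (auto simp: free_power_C2_def)
    then obtain w where "w \<in> C2.W" "fst gq = cls w"
      by (auto elim: C2.carrierE)
    with agree_along_trajectory[OF this(1) \<open>snd gq \<in> X\<close>]
    show "\<exists>P. finite P \<and> P \<subseteq> X \<and> (\<forall>Y \<pi>. P \<subseteq> Y \<longrightarrow> extends_letters Y \<pi> \<longrightarrow>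
        \<pi> (fst gq) (snd gq) = \<phi> (fst gq) (snd gq))" by simp
  qed
  then obtain P where P: "\<And>gq. gq \<in> K \<times> S \<Longrightarrow> finite (P gq) \<and> P gq \<subseteq> X \<and>
      (\<forall>Y \<pi>. P gq \<subseteq> Y \<longrightarrow> extends_letters Y \<pi> \<longrightarrow> \<pi> (fst gq) (snd gq) = \<phi> (fst gq) (snd gq))"
    by metis
  \<comment> \<open>Each trajectory condition holds for every larger set, so the union meets all of
    them at once; \<pi> is chosen only afterwards.\<close>
  define Y where "Y = S \<union> \<Union>(P ` (K \<times> S))"
  have Y: "finite Y" "S \<subseteq> Y" "Y \<subseteq> X"
  proof -
    show "finite Y" using assms(1,3) P by (simp add: Y_def)
    have "\<Union>(P ` (K \<times> S)) \<subseteq> X" using P by (intro UN_least) blast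
    then show "Y \<subseteq> X" using assms(4) by (simp add: Y_def)
  qed (simp add: Y_def)
  obtain \<pi> where \<pi>: "extends_letters Y \<pi>" using ex_extends_letters[OF Y(3)] by blast
  have "\<pi> g q = \<phi> g q" if "g \<in> K" "q \<in> S" for g q
  proof -
    have "P (g, q) \<subseteq> Y" using that by (auto simp: Y_def)
    then show ?thesis using P[of "(g, q)"] that \<pi> by auto
  qed
  then show ?thesis using Y \<pi> by (auto simp: extends_letters_def)
qed

end

theorem theorem3:
  fixes k :: nat
    and X :: "'x set"
    and \<phi> :: "(nat \<times> int) list set \<Rightarrow> 'x \<Rightarrow> 'x"
  assumes "k \<ge> 1"
    and "countable X" and "infinite X"
    and "transitive_action (free_power_C2 k) X \<phi>"
    and "faithful_action (free_power_C2 k) X \<phi>"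
  shows "LEF (lamplighter_group (free_power_C2 k) X \<phi>)"
proof -
  interpret free_power_C2_action k X \<phi>
    using assms(5) by (simp add: free_power_C2_action_def faithful_action_def)
  show ?thesis
    by (rule LEF_lamplighter_group[OF assms(5) ex_finite_approximation])
qed

end
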